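(* Let $\mathbb{D}$ be a division ring, let $2\le m,n<\infty$, let $P$ be an $n\times m$ matrix over $\mathbb{D}$ with $\operatorname{rank}P=r\ge 2$, and let $\mathcal{A}=\mathfrak{M}(\mathbb{D}, m, n, P)$. Then $\xi(\mathcal{A})$ is defined and $$\lceil \min\{m,n\}/r\rceil \le \xi(\mathcal{A}) \le \lceil \min\{m,n\}/r\rceil + 3,$$ where $\lceil x\rceil$ denotes the smallest integer $\ge x$.
   Context: $\mathfrak{M}(\mathbb{D}, m, n, P)$ denotes the ring of all $m\times n$ matrices over the division ring $\mathbb{D}$ with entrywise addition and multiplication $A\bullet B = APB$. The commutator is $[x,y]=x\bullet y-y\bullet x$; $[X,Y]=\{[x,y]:x\in X,y\in Y\}$, $XY=\{x\bullet y:x\in X,y\in Y\}$, and $\sum^N S$ denotes the set of sums of $N$ elements of $S$. For a ring $\mathbb{R}$ for which some $N\in\mathbb{N}$ satisfies $\mathbb{R}=\sum^N[\mathbb{R},\mathbb{R}][\mathbb{R},\mathbb{R}]$, $\xi(\mathbb{R})$ is the least such $N$. *)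

theory Defs
  imports "HOL-Analysis.Finite_Cartesian_Product"
begin

text \<open>Matrices: an m x n matrix over 'a is of type 'a^'n^'m (rows indexed by 'm, columns by 'n).
  The ring M(D,m,n,P) has carrier all m x n matrices, entrywise addition, and product A.B = A P B
  where P :: 'a^'m^'n is an n x m matrix.\<close>

definition smult_P :: "'a::ring_1^'m^'n \<Rightarrow> 'a^'n^'m \<Rightarrow> 'a^'n^'m \<Rightarrow> 'a^'n^'m" where
  "smult_P P A B = (A ** P) ** B"

definition comm_P :: "'a::ring_1^'m^'n \<Rightarrow> 'a^'n^'m \<Rightarrow> 'a^'n^'m \<Rightarrow> 'a^'n^'m" where
  "comm_P P x y = smult_P P x y - smult_P P y x"

definition comms_P :: "'a::ring_1^'m^'n \<Rightarrow> ('a^'n^'m) set" where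
  "comms_P P = {comm_P P x y | x y. True}"

definition comm_prods_P :: "'a::ring_1^'m^'n \<Rightarrow> ('a^'n^'m) set" where
  "comm_prods_P P = {smult_P P a b | a b. a \<in> comms_P P \<and> b \<in> comms_P P}"

definition sumsN :: "nat \<Rightarrow> 'b::monoid_add set \<Rightarrow> 'b set" where
  "sumsN N S = {sum_list xs | xs. length xs = N \<and> set xs \<subseteq> S}"

definition xi_P :: "'a::ring_1^'m^'n \<Rightarrow> nat" where
  "xi_P P = (LEAST N. sumsN N (comm_prods_P P) = (UNIV :: ('a^'n^'m) set))"

text \<open>Rank of a matrix over a division ring: dimension of its column space (a right vector space),
  i.e. the maximal number of right linearly independent columns.\<close>
definition cols_right_indep :: "'a::ring_1^'c^'r \<Rightarrow> 'c set \<Rightarrow> bool" where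
  "cols_right_indep M J \<longleftrightarrow>
     (\<forall>c :: 'c \<Rightarrow> 'a. (\<forall>i. (\<Sum>j\<in>J. M $ i $ j * c j) = 0) \<longrightarrow> (\<forall>j\<in>J. c j = 0))"

definition mat_rank :: "'a::ring_1^'c::finite^'r \<Rightarrow> nat" where
  "mat_rank M = Max {card J | J. cols_right_indep M J}"

end

theory Submission
  imports Defs
begin

text \<open>
  An invertible \<open>r \<times> r\<close> submatrix of \<open>P\<close>, with row set \<open>I\<close>, yields a generalized inverse \<open>W\<close> with
  \<open>P W P = P\<close> and \<open>e P W = e\<close>, where \<open>e\<close> is the diagonal idempotent of \<open>I\<close>. Hence
  \<open>C \<bullet> D = (C P W) (e P D)\<close> has rank at most \<open>r\<close>, which gives the lower bound.

  Conversely, \<open>\<gamma> \<delta>\<close> is a product of two commutators as soon as the corner parts \<open>e P \<gamma>\<close> and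
  \<open>\<delta> P W\<close> are commutators with an invertible entry in the corner ring \<open>e M\<^sub>n(D) e\<close>, that is, in
  \<open>M\<^sub>r(D)\<close>; the remaining parts of \<open>\<gamma>\<close> and \<open>\<delta>\<close> are arbitrary. Triangular matrices whose diagonal
  sums to zero are such commutators. Writing the corner part of a matrix \<open>X\<close> as a sum of four products
  of triangular matrices whose left factors are jointly surjective and whose right factors are
  jointly injective, four products match \<open>X\<close> up to a matrix \<open>(1 - W P) Y (1 - P W)\<close>. The latter has
  rank at most \<open>min m n - r\<close>, so \<open>\<lceil>min m n / r\<rceil> - 1\<close> products with vanishing corner parts suffice for it.
\<close>

section \<open>Matrix arithmetic over noncommutative rings\<close>

lemma matrix_mult_component:
  "(A ** B) $ i $ j = (\<Sum>k\<in>UNIV. A $ i $ k * B $ k $ j)"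
  by (simp add: matrix_matrix_mult_def)

lemma matrix_add_rdistrib: "(A + B) ** C = A ** C + B ** C"
  by (vector matrix_matrix_mult_def sum.distrib[symmetric] distrib_right)

lemma matrix_diff_ldistrib:
  fixes A :: "'a::ring_1^'n^'m"
  shows "A ** (B - C) = A ** B - A ** C"
  by (vector matrix_matrix_mult_def sum_subtractf[symmetric] right_diff_distrib)

lemma matrix_diff_rdistrib:
  fixes A :: "'a::ring_1^'n^'m"
  shows "(A - B) ** C = A ** C - B ** C"
  by (vector matrix_matrix_mult_def sum_subtractf[symmetric] left_diff_distrib)

lemmas matrix_distribs =
  matrix_add_ldistrib matrix_add_rdistrib matrix_diff_ldistrib matrix_diff_rdistrib

lemma matrix_sum_ldistrib: "A ** (\<Sum>x\<in>S. B x) = (\<Sum>x\<in>S. A ** B x)"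
  by (induction S rule: infinite_finite_induct) (auto simp: matrix_add_ldistrib)

lemma matrix_sum_rdistrib: "(\<Sum>x\<in>S. B x) ** A = (\<Sum>x\<in>S. B x ** A)"
  by (induction S rule: infinite_finite_induct) (auto simp: matrix_add_rdistrib)

lemma matrix_mult_cancel_tail2: "A ** B = C \<Longrightarrow> A ** (B ** X) = C ** X"
  by (metis matrix_mul_assoc)

definition diag_ind :: "'n set \<Rightarrow> 'a::ring_1^'n^'n" where
  "diag_ind I = (\<chi> i j. if i = j \<and> i \<in> I then 1 else 0)"

lemma diag_ind_mult_component:
  fixes A :: "'a::ring_1^'p^'n::finite"
  shows "(diag_ind I ** A) $ i $ j = (if i \<in> I then A $ i $ j else 0)"
proof -
  have "(diag_ind I ** A) $ i $ j = (\<Sum>k\<in>UNIV. if i = k then (if i \<in> I then A $ i $ j else 0) else 0)"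
    unfolding matrix_mult_component by (rule sum.cong) (auto simp: diag_ind_def)
  then show ?thesis by simp
qed

lemma mult_diag_ind_component:
  fixes A :: "'a::ring_1^'n::finite^'p"
  shows "(A ** diag_ind I) $ i $ j = (if j \<in> I then A $ i $ j else 0)"
proof -
  have "(A ** diag_ind I) $ i $ j = (\<Sum>k\<in>UNIV. if j = k then (if j \<in> I then A $ i $ j else 0) else 0)"
    unfolding matrix_mult_component by (rule sum.cong) (auto simp: diag_ind_def)
  then show ?thesis by simp
qed

lemma diag_ind_idem:
  fixes I :: "'n::finite set"
  shows "diag_ind I ** diag_ind I = diag_ind I"
  by (simp add: vec_eq_iff diag_ind_mult_component) (simp add: diag_ind_def)

section \<open>Linear systems and rank over a division ring\<close>

text \<open>Gaussian elimination, by induction on the number of equations; \<open>M\<close> is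
  generalised because eliminating an unknown changes the coefficients. Coefficients stand to the
  left of unknowns, so the inverse \<open>q\<close> of the pivot goes between \<open>M i j0\<close>
  and \<open>M i0 j\<close>.\<close>

lemma homogeneous_system_nontrivial_solution:
  fixes M :: "'i \<Rightarrow> 'j \<Rightarrow> 'a::division_ring"
  assumes "finite R" "finite C" "card R < card C"
  shows "\<exists>c. (\<exists>j\<in>C. c j \<noteq> 0) \<and> (\<forall>i\<in>R. (\<Sum>j\<in>C. M i j * c j) = 0)"
  using assms
proof (induction R arbitrary: M C rule: finite_induct)
  case empty
  then obtain j where "j \<in> C" by (metis card.empty ex_in_conv less_irrefl)
  then show ?case by (intro exI[of _ "\<lambda>_. 1"]) auto
next
  case (insert i0 R)
  show ?case
  proof (cases "\<forall>j\<in>C. M i0 j = 0")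
    case True
    have "card R < card C" using insert by simp
    from insert.IH[OF insert.prems(1) this, of M]
    obtain c where "\<exists>j\<in>C. c j \<noteq> 0" "\<forall>i\<in>R. (\<Sum>j\<in>C. M i j * c j) = 0" by blast
    moreover from True have "(\<Sum>j\<in>C. M i0 j * c j) = 0" by simp
    ultimately show ?thesis by blast
  next
    case False
    then obtain j0 where j0: "j0 \<in> C" "M i0 j0 \<noteq> 0" by blast
    define q where "q = inverse (M i0 j0)"
    define C' where "C' = C - {j0}"
    have C': "finite C'" "card R < card C'"
      using insert j0 by (auto simp: C'_def card_Diff_singleton)
    obtain c j1 where c: "j1 \<in> C'" "c j1 \<noteq> 0"
      and ceq: "\<And>i. i \<in> R \<Longrightarrow> (\<Sum>j\<in>C'. (M i j - M i j0 * q * M i0 j) * c j) = 0"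
      using insert.IH[OF C', of "\<lambda>i j. M i j - M i j0 * q * M i0 j"] by blast
    define s where "s = (\<Sum>j\<in>C'. M i0 j * c j)"
    define c' where "c' = c(j0 := - q * s)"
    have split: "(\<Sum>j\<in>C. M i j * c' j) = - M i j0 * q * s + (\<Sum>j\<in>C'. M i j * c j)" for i
    proof -
      have "(\<Sum>j\<in>C. M i j * c' j) = M i j0 * c' j0 + (\<Sum>j\<in>C'. M i j * c' j)"
        using insert.prems(1) j0(1) unfolding C'_def by (rule sum.remove)
      also have "(\<Sum>j\<in>C'. M i j * c' j) = (\<Sum>j\<in>C'. M i j * c j)"
        by (rule sum.cong) (auto simp: c'_def C'_def)
      finally show ?thesis by (simp add: c'_def mult.assoc)
    qed
    have "(\<Sum>j\<in>C. M i0 j * c' j) = 0"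
      unfolding split using j0 by (simp add: q_def s_def)
    moreover have "(\<Sum>j\<in>C. M i j * c' j) = 0" if "i \<in> R" for i
    proof -
      have "0 = (\<Sum>j\<in>C'. M i j * c j) - (\<Sum>j\<in>C'. M i j0 * q * (M i0 j * c j))"
        using ceq[OF that] by (simp add: left_diff_distrib sum_subtractf mult.assoc)
      then show ?thesis unfolding split by (simp add: s_def sum_distrib_left sum_negf)
    qed
    moreover have "c' j1 \<noteq> 0" "j1 \<in> C" using c by (auto simp: c'_def C'_def)
    ultimately show ?thesis by blast
  qed
qed

lemma cols_right_indep_card_le:
  fixes M :: "'a::division_ring^'c::finite^'r"
  assumes "finite I" and "\<And>c. \<forall>i\<in>I. (\<Sum>j\<in>J. M $ i $ j * c j) = 0 \<Longrightarrow> \<forall>j\<in>J. c j = 0"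
  shows "card J \<le> card I"
proof (rule ccontr)
  assume "\<not> card J \<le> card I"
  then have "card I < card J" by simp
  from homogeneous_system_nontrivial_solution[OF assms(1) _ this, of "\<lambda>i j. M $ i $ j"]
  show False using assms(2) by (metis finite)
qed

section \<open>Rank, invertible submatrices and generalized inverses\<close>

lemma mat_rank_witness:
  fixes M :: "'a::ring_1^'c::finite^'r"
  obtains J where "cols_right_indep M J" "card J = mat_rank M"
    "\<And>J'. cols_right_indep M J' \<Longrightarrow> card J' \<le> mat_rank M"
proof -
  let ?S = "{card J | J. cols_right_indep M J}"
  have fin: "finite ?S"
    by (rule finite_subset[of _ "{..CARD('c)}"]) (auto intro: card_mono)
  have "cols_right_indep M {}" by (simp add: cols_right_indep_def)
  then have "?S \<noteq> {}" by blast
  then have "mat_rank M \<in> ?S" unfolding mat_rank_def using fin by (rule Max_in[rotated])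
  moreover have "card J' \<le> mat_rank M" if "cols_right_indep M J'" for J'
    unfolding mat_rank_def using fin that by (intro Max_ge) auto
  ultimately show ?thesis using that by force
qed

text \<open>Adding a column \<open>l\<close> outside \<open>J\<close> creates a relation;
  independence of \<open>J\<close> forces its coefficient at \<open>l\<close> to be nonzero, and
  dividing by it on the right expresses column \<open>l\<close>.\<close>

lemma maximal_independent_columns_span:
  fixes M :: "'a::division_ring^'c::finite^'r"
  assumes J: "cols_right_indep M J"
    and max: "\<And>J'. cols_right_indep M J' \<Longrightarrow> card J' \<le> card J"
  shows "\<exists>c. \<forall>i. M $ i $ l = (\<Sum>j\<in>J. M $ i $ j * c j)"
proof (cases "l \<in> J")
  case True
  have "M $ i $ l = (\<Sum>j\<in>J. M $ i $ j * (if j = l then 1 else 0))" for i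
    using True by (simp add: if_distrib cong: if_cong)
  then show ?thesis by (intro exI[of _ "\<lambda>j. if j = l then 1 else 0"] allI)
next
  case False
  have "\<not> cols_right_indep M (insert l J)"
    using max[of "insert l J"] False by auto
  then obtain c where c: "\<And>i. (\<Sum>j\<in>insert l J. M $ i $ j * c j) = 0"
    and nz: "\<exists>j\<in>insert l J. c j \<noteq> 0"
    unfolding cols_right_indep_def by blast
  have eq: "M $ i $ l * c l + (\<Sum>j\<in>J. M $ i $ j * c j) = 0" for i
    using c[of i] False by simp
  have cl: "c l \<noteq> 0"
  proof
    assume "c l = 0"
    then have "\<forall>j\<in>J. c j = 0" using eq J unfolding cols_right_indep_def by auto
    with \<open>c l = 0\<close> nz show False by blast
  qed
  have "M $ i $ l = (\<Sum>j\<in>J. M $ i $ j * (- c j * inverse (c l)))" for i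
  proof -
    have "M $ i $ l * c l = - (\<Sum>j\<in>J. M $ i $ j * c j)"
      using eq[of i] by (simp add: eq_neg_iff_add_eq_0)
    then have "M $ i $ l * c l * inverse (c l) = - (\<Sum>j\<in>J. M $ i $ j * c j) * inverse (c l)"
      by simp
    then show ?thesis using cl
      by (simp add: mult.assoc sum_distrib_right sum_negf)
  qed
  then show ?thesis by (intro exI[of _ "\<lambda>j. - c j * inverse (c l)"]) blast
qed

text \<open>If \<open>I\<close> is a minimal set of rows on which the columns in \<open>J\<close> stay independent, then
  dropping a row \<open>i\<close> yields a vector annihilated by all other rows of \<open>I\<close>; these vectors,
  normalised, are the columns of a right inverse of the submatrix.\<close>
lemma independent_columns_invertible_submatrix:
  fixes M :: "'a::division_ring^'c::finite^'r::finite"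
  assumes J: "cols_right_indep M J"
  obtains I and W :: "'a^'r^'c" where "card I = card J"
    "\<And>j i. j \<notin> J \<or> i \<notin> I \<Longrightarrow> W $ j $ i = 0"
    "diag_ind I ** M ** W = diag_ind I" "W ** M ** diag_ind J = diag_ind J"
proof -
  define indep where "indep I \<longleftrightarrow>
    (\<forall>c. (\<forall>i\<in>I. (\<Sum>j\<in>J. M $ i $ j * c j) = 0) \<longrightarrow> (\<forall>j\<in>J. c j = 0))" for I
  have "indep UNIV" using J by (simp add: indep_def cols_right_indep_def)
  then obtain I where I: "indep I" and Imin: "\<And>I'. I' \<subset> I \<Longrightarrow> \<not> indep I'"
    using finite_has_minimal[of "{I. indep I}"] by (metis (mono_tags, lifting) empty_iff finite
        mem_Collect_eq psubset_eq)
  have "\<exists>c. (\<forall>k\<in>I. (\<Sum>j\<in>J. M $ k $ j * c j) = (if k = i then 1 else 0))" if i: "i \<in> I" for i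
  proof -
    have "\<not> indep (I - {i})" using Imin i by blast
    then obtain c where c: "\<And>k. k \<in> I - {i} \<Longrightarrow> (\<Sum>j\<in>J. M $ k $ j * c j) = 0"
      and nz: "\<not> (\<forall>j\<in>J. c j = 0)"
      unfolding indep_def by blast
    define s where "s = (\<Sum>j\<in>J. M $ i $ j * c j)"
    have "s \<noteq> 0"
      using I c nz unfolding indep_def s_def by (metis DiffI empty_iff insert_iff)
    have "(\<Sum>j\<in>J. M $ k $ j * (c j * inverse s)) = (if k = i then 1 else 0)" if "k \<in> I" for k
    proof -
      have "(\<Sum>j\<in>J. M $ k $ j * (c j * inverse s)) = (\<Sum>j\<in>J. M $ k $ j * c j) * inverse s"
        by (simp add: sum_distrib_right mult.assoc)
      then show ?thesis using c[of k] that \<open>s \<noteq> 0\<close> by (auto simp: s_def)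
    qed
    then show ?thesis by (intro exI[of _ "\<lambda>j. c j * inverse s"]) blast
  qed
  then obtain w where w: "\<And>i k. i \<in> I \<Longrightarrow> k \<in> I \<Longrightarrow>
      (\<Sum>j\<in>J. M $ k $ j * w i j) = (if k = i then 1 else 0)"
    by metis
  define W :: "'a^'r^'c" where "W = (\<chi> j i. if j \<in> J \<and> i \<in> I then w i j else 0)"
  have MW: "(M ** W) $ k $ i = (if k = i then 1 else 0)" if "i \<in> I" "k \<in> I" for i k
  proof -
    have "(M ** W) $ k $ i = (\<Sum>j\<in>J. M $ k $ j * w i j)"
      unfolding matrix_mult_component W_def using that
      by (intro sum.mono_neutral_cong_right) auto
    then show ?thesis using w that by simp
  qed
  have MW0: "(M ** W) $ k $ i = 0" if "i \<notin> I" for i k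
    using that by (simp add: matrix_mult_component W_def)
  have 1: "diag_ind I ** M ** W = diag_ind I"
    unfolding vec_eq_iff matrix_mul_assoc[symmetric] diag_ind_mult_component
    using MW MW0 by (fastforce simp: diag_ind_def)
  \<comment> \<open>The right inverse is also a left inverse: \<open>c\<close>, a column of
    \<open>W ** M\<close> minus a unit vector, is killed by the rows in \<open>I\<close>, since
    \<open>M ** W ** M\<close> agrees with \<open>M\<close> there. Then \<open>indep I\<close>
    forces \<open>c\<close> to vanish on \<open>J\<close>.\<close>
  have WM: "(W ** M) $ j $ l = (if j = l then 1 else 0)" if j: "j \<in> J" and l: "l \<in> J" for j l
  proof -
    define c where "c j = (W ** M) $ j $ l - (if j = l then 1 else 0)" for j
    have "(\<Sum>j\<in>J. M $ k $ j * c j) = 0" if k: "k \<in> I" for k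
    proof -
      have "(\<Sum>j\<in>J. M $ k $ j * (W ** M) $ j $ l) = (\<Sum>j\<in>UNIV. M $ k $ j * (W ** M) $ j $ l)"
        by (rule sum.mono_neutral_left) (auto simp: W_def matrix_mult_component)
      also have "\<dots> = (M ** (W ** M)) $ k $ l" by (simp add: matrix_mult_component)
      also have "\<dots> = (diag_ind I ** M ** W ** M) $ k $ l"
        using k by (simp add: diag_ind_mult_component matrix_mul_assoc[symmetric])
      also have "\<dots> = M $ k $ l" unfolding 1 using k by (simp add: diag_ind_mult_component)
      finally have "(\<Sum>j\<in>J. M $ k $ j * (W ** M) $ j $ l) = M $ k $ l" .
      moreover have "(\<Sum>j\<in>J. M $ k $ j * (if j = l then 1 else 0)) = M $ k $ l"
        using l by (simp add: if_distrib cong: if_cong)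
      ultimately show ?thesis by (simp add: c_def right_diff_distrib sum_subtractf)
    qed
    then have "c j = 0" using I j unfolding indep_def by blast
    then show ?thesis by (simp add: c_def)
  qed
  have WM0: "(W ** M) $ j $ l = 0" if "j \<notin> J" for j l
    using that by (simp add: matrix_mult_component W_def)
  have 2: "W ** M ** diag_ind J = diag_ind J"
    unfolding vec_eq_iff mult_diag_ind_component
    using WM WM0 by (fastforce simp: diag_ind_def)
  have "card J \<le> card I"
    using I by (intro cols_right_indep_card_le[where I = I and J = J and M = M]) (auto simp: indep_def)
  \<comment> \<open>Since \<open>M ** W\<close> is the identity on \<open>I\<close>, the columns of
    \<open>W\<close> in \<open>I\<close> are independent; they are supported on the rows in
    \<open>J\<close>.\<close>
  moreover have "card I \<le> card J"
  proof (rule cols_right_indep_card_le[where I = J and J = I and M = W], simp)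
    fix c assume c: "\<forall>j\<in>J. (\<Sum>i\<in>I. W $ j $ i * c i) = 0"
    show "\<forall>i\<in>I. c i = 0"
    proof
      fix k assume k: "k \<in> I"
      have "c k = (\<Sum>i\<in>I. (M ** W) $ k $ i * c i)"
        using MW k by (simp add: if_distrib[of "\<lambda>x. x * _"] cong: if_cong)
      also have "\<dots> = (\<Sum>i\<in>I. \<Sum>j\<in>UNIV. M $ k $ j * (W $ j $ i * c i))"
        by (simp add: matrix_mult_component sum_distrib_right mult.assoc)
      also have "\<dots> = (\<Sum>j\<in>UNIV. M $ k $ j * (\<Sum>i\<in>I. W $ j $ i * c i))"
        by (subst sum.swap) (simp add: sum_distrib_left)
      also have "\<dots> = 0"
      proof (intro sum.neutral ballI)
        fix j
        show "M $ k $ j * (\<Sum>i\<in>I. W $ j $ i * c i) = 0"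
          using c by (cases "j \<in> J") (auto simp: W_def)
      qed
      finally show "c k = 0" .
    qed
  qed
  ultimately have "card I = card J" by simp
  then show ?thesis by (rule that[OF _ _ 1 2]) (auto simp: W_def)
qed

text \<open>A maximal independent set \<open>J\<close> of columns spans all columns, so
  \<open>P = P ** diag_ind J ** C\<close> for some \<open>C\<close>. As \<open>W ** P\<close> fixes
  \<open>diag_ind J\<close>, this yields \<open>P ** W ** P = P\<close>.\<close>

lemma mat_rank_generalized_inverse:
  fixes P :: "'a::division_ring^'m::finite^'n::finite"
  obtains I J and W :: "'a^'n^'m" where "card I = mat_rank P" "card J = mat_rank P"
    "P ** W ** P = P" "W ** diag_ind I = W" "diag_ind I ** P ** W = diag_ind I"
    "W ** P ** diag_ind J = diag_ind J"
proof -
  obtain J where J: "cols_right_indep P J" "card J = mat_rank P"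
    and max: "\<And>J'. cols_right_indep P J' \<Longrightarrow> card J' \<le> mat_rank P"
    using mat_rank_witness by blast
  obtain I and W :: "'a^'n^'m" where IW: "card I = card J"
    "\<And>j i. j \<notin> J \<or> i \<notin> I \<Longrightarrow> W $ j $ i = 0"
    "diag_ind I ** P ** W = diag_ind I" "W ** P ** diag_ind J = diag_ind J"
    using independent_columns_invertible_submatrix[OF J(1)] by metis
  have "\<exists>c. \<forall>i. P $ i $ l = (\<Sum>j\<in>J. P $ i $ j * c j)" for l
    using maximal_independent_columns_span[OF J(1)] max J(2) by simp
  then obtain c where c: "\<And>l i. P $ i $ l = (\<Sum>j\<in>J. P $ i $ j * c l j)" by metis
  define C :: "'a^'m^'m" where "C = (\<chi> j l. if j \<in> J then c l j else 0)"
  have P: "P = P ** diag_ind J ** C"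
  proof -
    have "(P ** diag_ind J ** C) $ i $ l = (\<Sum>j\<in>J. P $ i $ j * c l j)" for i l
      unfolding matrix_mult_component[of "P ** diag_ind J"] mult_diag_ind_component C_def
      by (rule sum.mono_neutral_cong_right) auto
    then show ?thesis by (simp add: vec_eq_iff c[symmetric])
  qed
  have "P ** W ** P = P ** (W ** P ** diag_ind J) ** C"
    by (subst (2) P) (simp add: matrix_mul_assoc)
  also have "\<dots> = P" unfolding IW(4) using P by simp
  finally have "P ** W ** P = P" .
  moreover have "W ** diag_ind I = W"
    using IW(2) by (auto simp: vec_eq_iff mult_diag_ind_component)
  ultimately show ?thesis using that IW J(2) by simp
qed

section \<open>Commutators in a corner of the matrix ring\<close>

text \<open>\<open>unit_comm e G\<close>: \<open>G\<close> is a commutator of elements of the corner ring \<open>e R e\<close> one of which is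
  invertible there. The invertibility is what allows such a commutator to be lifted to the
  sandwich ring with prescribed values outside the corner.\<close>
definition unit_comm :: "'a::ring_1^'n^'n \<Rightarrow> 'a^'n^'n \<Rightarrow> bool" where
  "unit_comm e G \<longleftrightarrow> (\<exists>a a' b. e ** a = a \<and> a ** e = a \<and> e ** a' = a' \<and> a' ** e = a' \<and>
     e ** b = b \<and> b ** e = b \<and> a ** a' = e \<and> a' ** a = e \<and> G = a ** b - b ** a)"

lemma unit_comm_zero: "e ** e = e \<Longrightarrow> unit_comm e 0"
  unfolding unit_comm_def by (intro exI[of _ e] exI[of _ 0]) simp

lemma unit_comm_corner: "unit_comm e G \<Longrightarrow> e ** G = G \<and> G ** e = G"
  unfolding unit_comm_def
  by (auto simp: matrix_diff_ldistrib matrix_diff_rdistrib matrix_mul_assoc[symmetric])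
    (simp_all add: matrix_mul_assoc)

text \<open>The index type has no order. Numbering the corner's indices by naturals through
  \<open>f\<close> gives a meaning to shifts and triangular matrices.\<close>

definition corner :: "(nat \<Rightarrow> 'n) \<Rightarrow> nat \<Rightarrow> (nat \<Rightarrow> nat \<Rightarrow> 'a::ring_1) \<Rightarrow> 'a^'n^'n" where
  "corner f r M = (\<chi> a b. if a \<in> f ` {..<r} \<and> b \<in> f ` {..<r}
     then M (inv_into {..<r} f a) (inv_into {..<r} f b) else 0)"

context
  fixes f :: "nat \<Rightarrow> 'n::finite" and r :: nat
  assumes inj: "inj_on f {..<r}"
begin

lemma corner_component: "i < r \<Longrightarrow> j < r \<Longrightarrow> corner f r M $ f i $ f j = M i j"
  using inj by (simp add: corner_def)

lemma corner_outside:
  "a \<notin> f ` {..<r} \<or> b \<notin> f ` {..<r} \<Longrightarrow> corner f r M $ a $ b = 0"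
  by (auto simp: corner_def)

lemma corner_eqI:
  assumes "\<And>a b. a \<notin> f ` {..<r} \<or> b \<notin> f ` {..<r} \<Longrightarrow> X $ a $ b = 0"
    and "\<And>i j. i < r \<Longrightarrow> j < r \<Longrightarrow> X $ f i $ f j = M i j"
  shows "X = corner f r M"
proof -
  have "X $ a $ b = corner f r M $ a $ b" for a b
  proof (cases "a \<in> f ` {..<r} \<and> b \<in> f ` {..<r}")
    case True
    then obtain i j where "i < r" "j < r" "a = f i" "b = f j" by auto
    then show ?thesis by (simp add: assms(2) corner_component)
  qed (use assms(1) corner_outside in metis)
  then show ?thesis by (simp add: vec_eq_iff)
qed

lemma corner_cong:
  "(\<And>i j. i < r \<Longrightarrow> j < r \<Longrightarrow> M i j = M' i j) \<Longrightarrow> corner f r M = corner f r M'"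
  by (rule corner_eqI) (auto simp: corner_outside corner_component)

lemma corner_mult:
  "corner f r M ** corner f r M' = corner f r (\<lambda>i j. \<Sum>k<r. M i k * M' k j)"
proof (rule corner_eqI)
  fix a b assume "a \<notin> f ` {..<r} \<or> b \<notin> f ` {..<r}"
  then show "(corner f r M ** corner f r M') $ a $ b = 0"
    unfolding matrix_mult_component by (intro sum.neutral) (auto simp: corner_outside)
next
  fix i j assume ij: "i < r" "j < r"
  have "(corner f r M ** corner f r M') $ f i $ f j
    = (\<Sum>c\<in>f ` {..<r}. corner f r M $ f i $ c * corner f r M' $ c $ f j)"
    unfolding matrix_mult_component by (rule sum.mono_neutral_right) (auto simp: corner_outside)
  also have "\<dots> = (\<Sum>k<r. M i k * M' k j)"
    by (subst sum.reindex[OF inj]) (use ij in \<open>auto simp: corner_component\<close>)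
  finally show "(corner f r M ** corner f r M') $ f i $ f j = (\<Sum>k<r. M i k * M' k j)" .
qed

lemma corner_add: "corner f r M + corner f r M' = corner f r (\<lambda>i j. M i j + M' i j)"
  by (simp add: corner_def vec_eq_iff)

lemma corner_diff: "corner f r M - corner f r M' = corner f r (\<lambda>i j. M i j - M' i j)"
  by (simp add: corner_def vec_eq_iff)

lemma corner_one: "diag_ind (f ` {..<r}) = corner f r (\<lambda>i j. if i = j then 1 else 0)"
  by (rule corner_eqI) (use inj in \<open>auto simp: diag_ind_def inj_on_def\<close>)

lemma corner_left_one: "diag_ind (f ` {..<r}) ** corner f r M = corner f r M"
  unfolding vec_eq_iff diag_ind_mult_component by (auto simp: corner_outside)

lemma corner_right_one: "corner f r M ** diag_ind (f ` {..<r}) = corner f r M"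
  unfolding vec_eq_iff mult_diag_ind_component by (auto simp: corner_outside)

lemma corner_represent:
  assumes "diag_ind (f ` {..<r}) ** X = X" "X ** diag_ind (f ` {..<r}) = X"
  shows "X = corner f r (\<lambda>i j. X $ f i $ f j)"
proof (rule corner_eqI)
  fix a b assume "a \<notin> f ` {..<r} \<or> b \<notin> f ` {..<r}"
  then show "X $ a $ b = 0"
    by (metis assms diag_ind_mult_component mult_diag_ind_component)
qed simp

end

text \<open>Reversing the numbering turns lower triangular matrices into upper triangular ones and
  leaves the corner itself unchanged.\<close>

lemma corner_reverse:
  assumes "inj_on f {..<r}"
  shows "corner f r M = corner (\<lambda>i. f (r - 1 - i)) r (\<lambda>i j. M (r - 1 - i) (r - 1 - j))"
    and "inj_on (\<lambda>i. f (r - 1 - i)) {..<r}"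
    and "(\<lambda>i. f (r - 1 - i)) ` {..<r} = f ` {..<r}"
proof -
  show inj': "inj_on (\<lambda>i. f (r - 1 - i)) {..<r}"
  proof (rule inj_onI)
    fix i j assume "i \<in> {..<r}" "j \<in> {..<r}" "f (r - 1 - i) = f (r - 1 - j)"
    moreover from this have "r - 1 - i = r - 1 - j"
      by (intro inj_onD[OF assms]) auto
    ultimately show "i = j" by auto
  qed
  have "(\<lambda>i. r - 1 - i) ` {..<r} = {..<r}"
    by (rule endo_inj_surj) (auto simp: inj_on_def)
  then show img: "(\<lambda>i. f (r - 1 - i)) ` {..<r} = f ` {..<r}"
    by (metis image_image)
  show "corner f r M = corner (\<lambda>i. f (r - 1 - i)) r (\<lambda>i j. M (r - 1 - i) (r - 1 - j))"
    by (rule corner_eqI[OF inj', unfolded img]) (auto simp: corner_outside[OF assms] corner_component[OF assms])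
qed

section \<open>Triangular matrices with zero trace as commutators\<close>

lemma sum_if_eq_mult:
  fixes g :: "nat \<Rightarrow> 'a::semiring_1"
  shows "(\<Sum>k<r. (if k = c then x else 0) * g k) = (if c < r then x * g c else 0)"
proof -
  have "(\<Sum>k<r. (if k = c then x else 0) * g k) = (\<Sum>k<r. if k = c then x * g c else 0)"
    by (rule sum.cong) auto
  then show ?thesis by simp
qed

lemma sum_mult_if_eq:
  fixes g :: "nat \<Rightarrow> 'a::semiring_1"
  shows "(\<Sum>k<r. g k * (if k = c then x else 0)) = (if c < r then g c * x else 0)"
proof -
  have "(\<Sum>k<r. g k * (if k = c then x else 0)) = (\<Sum>k<r. if k = c then g c * x else 0)"
    by (rule sum.cong) auto
  then show ?thesis by simp
qed

text \<open>The solution \<open>b\<close> of \<open>M = [1 - N, b]\<close> for the shift \<open>N\<close>, obtained row by row from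
  \<open>M i j = b i (j - 1) - b (i + 1) j\<close>.\<close>
primrec shift_comm_sol :: "(nat \<Rightarrow> nat \<Rightarrow> 'a::ab_group_add) \<Rightarrow> nat \<Rightarrow> nat \<Rightarrow> 'a" where
  "shift_comm_sol M 0 j = 0"
| "shift_comm_sol M (Suc i) j = (if j = 0 then 0 else shift_comm_sol M i (j - 1)) - M i j"

lemma shift_comm_sol_below:
  assumes "\<And>i j. i < r \<Longrightarrow> j < i \<Longrightarrow> M i j = 0"
  shows "i \<le> r \<Longrightarrow> Suc j < i \<Longrightarrow> shift_comm_sol M i j = 0"
  by (induction i arbitrary: j) (auto simp: assms)

text \<open>The recursion moves along diagonals, so the entries just below the main diagonal
  accumulate the partial traces.\<close>

lemma shift_comm_sol_subdiag: "shift_comm_sol M (Suc i) i = - (\<Sum>t\<le>i. M t t)"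
  by (induction i) auto

text \<open>Adding 1 to minus the shift does not change its commutators but makes it invertible:
  \<open>a\<close> is 1 minus the shift, and \<open>a'\<close>, the sum of all powers of the shift,
  is its inverse.\<close>

lemma unit_comm_upper_triangular:
  fixes f :: "nat \<Rightarrow> 'n::finite" and M :: "nat \<Rightarrow> nat \<Rightarrow> 'a::ring_1"
  assumes inj: "inj_on f {..<r}"
    and upper: "\<And>i j. i < r \<Longrightarrow> j < i \<Longrightarrow> M i j = 0"
    and trace: "(\<Sum>i<r. M i i) = 0"
  shows "unit_comm (diag_ind (f ` {..<r})) (corner f r M)"
proof -
  define b where "b = shift_comm_sol M"
  define a :: "nat \<Rightarrow> nat \<Rightarrow> 'a" where
    "a i j = (if j = i then 1 else 0) - (if j = Suc i then 1 else 0)" for i j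
  define a' :: "nat \<Rightarrow> nat \<Rightarrow> 'a" where "a' i j = (if i \<le> j then 1 else 0)" for i j
  have a_left: "(\<Sum>k<r. a i k * g k) = g i - (if Suc i < r then g (Suc i) else 0)" if "i < r" for i g
    using that by (simp add: a_def left_diff_distrib sum_subtractf sum_if_eq_mult)
  have a_right: "(\<Sum>k<r. g k * a k j) = g j - (if j = 0 then 0 else g (j - 1))" if "j < r" for j g
  proof -
    \<comment> \<open>For \<open>j = 0\<close> the truncated \<open>j - 1\<close> is 0 again; the
      inner conditional removes this spurious term.\<close>
    have "a k j = (if k = j then 1 else 0) - (if k = j - 1 then if j = 0 then 0 else 1 else 0)" for k
      by (auto simp: a_def)
    then show ?thesis using that
      by (auto simp: right_diff_distrib sum_subtractf sum_mult_if_eq)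
  qed
  \<comment> \<open>Row \<open>r\<close> lies outside the matrix, so the recursion solves the
    equation in the last row only if this row vanishes. Left of its entry \<open>r - 1\<close> this
    follows from triangularity; that entry is minus the trace.\<close>
  have last: "b r j = 0" if "j < r" for j
  proof (cases "Suc j < r")
    case True
    then show ?thesis unfolding b_def using upper by (intro shift_comm_sol_below[of r]) auto
  next
    case False
    with that have "r = Suc j" by simp
    then show ?thesis using trace by (simp add: b_def shift_comm_sol_subdiag lessThan_Suc_atMost del: shift_comm_sol.simps)
  qed
  have "corner f r a ** corner f r a' = diag_ind (f ` {..<r})"
    unfolding corner_mult[OF inj] corner_one[OF inj]
    by (rule corner_cong[OF inj]) (auto simp: a_left a'_def)
  moreover have "corner f r a' ** corner f r a = diag_ind (f ` {..<r})"
    unfolding corner_mult[OF inj] corner_one[OF inj]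
    by (rule corner_cong[OF inj]) (auto simp: a_right a'_def)
  moreover have "corner f r M = corner f r a ** corner f r b - corner f r b ** corner f r a"
    unfolding corner_mult[OF inj] corner_diff[OF inj]
  proof (rule corner_cong[OF inj])
    fix i j assume ij: "i < r" "j < r"
    have "b (Suc i) j = (if j = 0 then 0 else b i (j - 1)) - M i j" by (simp add: b_def)
    moreover have "b (Suc i) j = 0" if "\<not> Suc i < r"
      using last[OF ij(2)] ij that by (metis Suc_lessI)
    ultimately show "M i j = (\<Sum>k<r. a i k * b k j) - (\<Sum>k<r. b i k * a k j)"
      using ij by (auto simp: a_left a_right)
  qed
  ultimately show ?thesis
    unfolding unit_comm_def using corner_left_one[OF inj] corner_right_one[OF inj] by metis
qed

lemma unit_comm_lower_triangular:
  fixes f :: "nat \<Rightarrow> 'n::finite" and M :: "nat \<Rightarrow> nat \<Rightarrow> 'a::ring_1"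
  assumes inj: "inj_on f {..<r}"
    and lower: "\<And>i j. j < r \<Longrightarrow> i < j \<Longrightarrow> M i j = 0"
    and trace: "(\<Sum>i<r. M i i) = 0"
  shows "unit_comm (diag_ind (f ` {..<r})) (corner f r M)"
  unfolding corner_reverse(1)[OF inj] corner_reverse(3)[OF inj, symmetric]
proof (rule unit_comm_upper_triangular[OF corner_reverse(2)[OF inj]])
  show "(\<Sum>i<r. M (r - 1 - i) (r - 1 - i)) = 0"
    using trace sum.nat_diff_reindex[of "\<lambda>i. M i i" r] by simp
qed (auto intro!: lower)

text \<open>With the shift \<open>N\<close> and its transpose \<open>T\<close>, the products \<open>N U\<close> and \<open>T L\<close> with \<open>U\<close> upper and
  \<open>L\<close> lower triangular fill the two strict triangles, while \<open>N L\<close> and \<open>T U\<close> with \<open>L\<close> and \<open>U\<close>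
  supported next to the diagonal fill the diagonal. The rows of \<open>U\<close> and \<open>L\<close> not seen by the
  products are free; they serve to make the traces zero and the right factors jointly injective.\<close>
lemma corner_sum_of_four_products:
  fixes f :: "nat \<Rightarrow> 'n::finite" and X :: "'a::ring_1^'n^'n"
  assumes inj: "inj_on f {..<r}" and r: "r \<ge> 2"
    and e: "e = diag_ind (f ` {..<r})" and X: "e ** X = X" "X ** e = X"
  obtains G H R K :: "nat \<Rightarrow> 'a^'n^'n" where
    "\<forall>i. unit_comm e (G i) \<and> unit_comm e (H i)" "\<forall>i. e ** R i = R i \<and> K i ** e = K i"
    "(\<Sum>i<4. G i ** H i) = X" "(\<Sum>i<4. G i ** R i) = e" "(\<Sum>i<4. K i ** H i) = e"
proof -
  define x where "x i j = X $ f i $ f j" for i j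
  have Xx: "X = corner f r x"
    unfolding x_def using corner_represent[OF inj] X by (simp add: e)
  define N :: "nat \<Rightarrow> nat \<Rightarrow> 'a" where "N i k = (if k = Suc i then 1 else 0)" for i k
  \<comment> \<open>The inner conditional keeps row 0 zero, where \<open>i - 1\<close> is truncated
    to 0.\<close>
  define T :: "nat \<Rightarrow> nat \<Rightarrow> 'a" where
    "T i k = (if k = i - 1 then if i = 0 then 0 else 1 else 0)" for i k
  \<comment> \<open>The free diagonal entries \<open>d\<close> of \<open>U1\<close> and
    \<open>d'\<close> of \<open>L2\<close> cancel the traces of the prescribed rows. The free corner
    entries \<open>1 + d * d'\<close> and \<open>1\<close> make the two free rows, read in columns 0
    and \<open>r - 1\<close>, an invertible 2 by 2 matrix.\<close>
  define d where "d = - (\<Sum>i<r-1. x i (Suc i))"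
  define d' where "d' = - (\<Sum>i<r-1. x (Suc i) i)"
  define U1 where "U1 i j = (if i = 0 then if j = 0 then d else if j = r - 1 then 1 + d * d' else 0
      else if i \<le> j then x (i - 1) j else 0)" for i j
  define L2 where "L2 i j = (if i = r - 1 then if j = r - 1 then d' else if j = 0 then 1 else 0
      else if j \<le> i then x (Suc i) j else 0)" for i j
  \<comment> \<open>The ones in \<open>L1\<close> provide the unit row vectors with index strictly
    between 0 and \<open>r - 1\<close>. They also add 1 to the diagonal of the sum at these indices,
    which \<open>U2\<close> subtracts again.\<close>
  define L1 where "L1 i j = (if i = Suc j then if j = 0 then x 0 0 else 1 else 0)" for i j
  define U2 where "U2 i j = (if j = Suc i then x j j - (if j < r - 1 then 1 else 0) else 0)" for i j
  \<comment> \<open>\<open>N\<close> times \<open>T\<close> is the identity except for a zero in the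
    last diagonal entry, which \<open>T\<close> times \<open>R2\<close> supplies.\<close>
  define R2 :: "nat \<Rightarrow> nat \<Rightarrow> 'a" where "R2 i j = (if i = r - 2 \<and> j = r - 1 then 1 else 0)" for i j
  \<comment> \<open>\<open>K0\<close> and \<open>K3\<close> hold the inverse of the 2 by 2 matrix
    formed by the free rows of \<open>U1\<close> and \<open>L2\<close>: the first row minus
    \<open>d\<close> times the second is the last unit vector, and subtracting \<open>d'\<close>
    times that from the second row leaves the unit vector at 0. \<open>K1\<close> selects the unit
    rows of \<open>L1\<close>.\<close>
  define K0 where "K0 i k = (if k = 0 then if i = r - 1 then 1 else if i = 0 then - d' else 0 else 0)" for i k :: nat
  define K1 :: "nat \<Rightarrow> nat \<Rightarrow> 'a" where "K1 i k = (if k = Suc i then if i = 0 then 0 else 1 else 0)" for i k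
  define K3 where "K3 i k = (if k = r - 1 then if i = r - 1 then - d else if i = 0 then 1 + d' * d else 0 else 0)"
    for i k
  let ?c = "corner f r"
  obtain q where q: "r = Suc (Suc q)" using r by (metis add_2_eq_Suc less_eqE)
  have Suc_r: "Suc (r - Suc (Suc 0)) = r - Suc 0" by (simp add: q)
  have tr1: "(\<Sum>i<r. U1 i i) = 0"
  proof -
    have "(\<Sum>i<Suc q. U1 (Suc i) (Suc i)) = (\<Sum>i<Suc q. x i (Suc i))" by (simp add: U1_def)
    then have "(\<Sum>i<Suc (Suc q). U1 i i) = 0"
      unfolding sum.lessThan_Suc_shift[of _ "Suc q"] by (simp add: U1_def d_def q)
    then show ?thesis by (simp only: q)
  qed
  have tr2: "(\<Sum>i<r. L2 i i) = 0"
  proof -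
    have "(\<Sum>i<Suc q. L2 i i) = (\<Sum>i<Suc q. x (Suc i) i)" by (rule sum.cong) (auto simp: L2_def q)
    then have "(\<Sum>i<Suc (Suc q). L2 i i) = 0"
      unfolding sum.lessThan_Suc[of _ "Suc q"] by (simp add: L2_def d'_def q)
    then show ?thesis by (simp only: q)
  qed
  have goodN: "unit_comm e (?c N)" and goodU1: "unit_comm e (?c U1)" and goodU2: "unit_comm e (?c U2)"
    unfolding e by (rule unit_comm_upper_triangular[OF inj]; use tr1 in \<open>auto simp: N_def U1_def U2_def\<close>)+
  have goodT: "unit_comm e (?c T)"
    unfolding e by (rule unit_comm_lower_triangular[OF inj]) (auto simp: T_def intro!: sum.neutral)
  have goodL1: "unit_comm e (?c L1)" and goodL2: "unit_comm e (?c L2)"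
    unfolding e by (rule unit_comm_lower_triangular[OF inj]; use tr2 in \<open>auto simp: L1_def L2_def\<close>)+
  have N_mult: "(\<Sum>k<r. N i k * g k) = (if Suc i < r then g (Suc i) else 0)" for i g
    by (simp add: N_def sum_if_eq_mult)
  have T_mult: "(\<Sum>k<r. T i k * g k) = (if i = 0 then 0 else g (i - 1))" if "i < r" for i g
    using that by (auto simp: T_def sum_if_eq_mult)
  define G where "G i = (if i < 2 then ?c N else ?c T)" for i :: nat
  define H where "H i = (if i = 0 then ?c U1 else if i = 1 then ?c L1 else if i = 2 then ?c U2 else ?c L2)"
    for i :: nat
  define R where "R i = (if i = 0 then ?c T else if i = 2 then ?c R2 else 0)" for i :: nat
  define K where "K i = (if i = 0 then ?c K0 else if i = 1 then ?c K1 else if i = 3 then ?c K3 else 0)"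
    for i :: nat
  have four: "(\<Sum>i<4. g i) = g 0 + g 1 + g 2 + g (3::nat)" for g :: "nat \<Rightarrow> 'a^'n^'n"
    by (simp add: numeral_eq_Suc)
  have "?c N ** ?c U1 + ?c N ** ?c L1 + ?c T ** ?c U2 + ?c T ** ?c L2 = ?c x"
    unfolding corner_mult[OF inj] corner_add[OF inj]
  proof (rule corner_cong[OF inj])
    fix i j assume "i < r" "j < r"
    then show "(\<Sum>k<r. N i k * U1 k j) + (\<Sum>k<r. N i k * L1 k j) + (\<Sum>k<r. T i k * U2 k j)
        + (\<Sum>k<r. T i k * L2 k j) = x i j"
      using r by (cases "i = 0"; cases "i = r - 1"; cases i j rule: linorder_cases)
        (auto simp: N_mult T_mult U1_def L1_def U2_def L2_def Suc_r)
  qed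
  then have GH: "(\<Sum>i<4. G i ** H i) = X"
    unfolding four Xx by (simp add: G_def H_def)
  have "?c N ** ?c T + ?c T ** ?c R2 = e"
    unfolding e corner_one[OF inj] corner_mult[OF inj] corner_add[OF inj]
  proof (rule corner_cong[OF inj])
    fix i j assume "i < r" "j < r"
    then show "(\<Sum>k<r. N i k * T k j) + (\<Sum>k<r. T i k * R2 k j) = (if i = j then 1 else 0)"
      using r by (auto simp: N_mult T_mult) (auto simp: T_def R2_def)
  qed
  then have GR: "(\<Sum>i<4. G i ** R i) = e"
    unfolding four by (simp add: G_def R_def)
  have "?c K0 ** ?c U1 + ?c K1 ** ?c L1 + ?c K3 ** ?c L2 = e"
    unfolding e corner_one[OF inj] corner_mult[OF inj] corner_add[OF inj]
  proof (rule corner_cong[OF inj])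
    fix i j assume ij: "i < r" "j < r"
    have "(\<Sum>k<r. K0 i k * U1 k j) = (if i = r - 1 then 1 else if i = 0 then - d' else 0) * U1 0 j"
      using r by (simp add: K0_def sum_if_eq_mult)
    moreover have "(\<Sum>k<r. K1 i k * L1 k j) = (if Suc i < r \<and> i \<noteq> 0 then L1 (Suc i) j else 0)"
      by (simp add: K1_def sum_if_eq_mult)
    moreover have "(\<Sum>k<r. K3 i k * L2 k j)
        = (if i = r - 1 then - d else if i = 0 then 1 + d' * d else 0) * L2 (r - 1) j"
      using r by (simp add: K3_def sum_if_eq_mult)
    ultimately show "(\<Sum>k<r. K0 i k * U1 k j) + (\<Sum>k<r. K1 i k * L1 k j) + (\<Sum>k<r. K3 i k * L2 k j)
        = (if i = j then 1 else 0)"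
      using r ij by (cases "i = 0"; cases "i = r - 1"; cases "j = 0"; cases "j = r - 1")
        (auto simp: U1_def L1_def L2_def algebra_simps)
  qed
  then have KH: "(\<Sum>i<4. K i ** H i) = e"
    unfolding four by (simp add: K_def H_def)
  show ?thesis
  proof (rule that[OF _ _ GH GR KH])
    show "\<forall>i. unit_comm e (G i) \<and> unit_comm e (H i)"
      using goodN goodT goodU1 goodU2 goodL1 goodL2 by (auto simp: G_def H_def)
    show "\<forall>i. e ** R i = R i \<and> K i ** e = K i"
      by (auto simp: R_def K_def e corner_left_one[OF inj] corner_right_one[OF inj])
  qed
qed

section \<open>Sums of products of commutators\<close>

context
  fixes P :: "'a::division_ring^'m::finite^'n::finite" and W :: "'a^'n^'m" and I :: "'n set"
    and e :: "'a^'n^'n"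
  assumes PWP: "P ** W ** P = P" and We: "W ** e = W" and ePW: "e ** P ** W = e"
    and e_def: "e = diag_ind I"
begin

lemma corner_unit_idem: "e ** e = e"
  by (simp add: e_def diag_ind_idem)

lemma mult_gen_inverse:
  assumes "A ** e = A"
  shows "A ** (P ** W) = A"
  by (metis assms ePW matrix_mul_assoc)

text \<open>It suffices to find commutators \<open>C\<close> and \<open>D\<close> with
  \<open>C ** P ** W = \<gamma>\<close> and \<open>e ** P ** D = \<delta>\<close>, because
  \<open>P ** W ** P = P\<close> allows \<open>W\<close> to be inserted in
  \<open>C ** P ** D\<close>. In each case one entry is \<open>W ** a\<close> with \<open>a\<close>
  invertible in the corner, and the other is found by dividing by \<open>a\<close>.\<close>

lemma product_mem_comm_prods:
  assumes \<gamma>: "\<gamma> ** e = \<gamma>" "unit_comm e (e ** P ** \<gamma>)"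
    and \<delta>: "e ** \<delta> = \<delta>" "unit_comm e (\<delta> ** P ** W)"
  shows "\<gamma> ** \<delta> \<in> comm_prods_P P"
proof -
  note assoc = matrix_mul_assoc[symmetric]
  have ePW': "e ** (P ** W) = e" using ePW by (simp add: assoc)
  have "\<exists>C\<in>comms_P P. C ** P ** W = \<gamma>"
  proof -
    obtain a a' b where a: "e ** a = a" "a ** e = a" "e ** a' = a'" "a' ** e = a'"
      "e ** b = b" "b ** e = b" "a ** a' = e" "a' ** a = e" and G: "e ** P ** \<gamma> = a ** b - b ** a"
      using \<gamma>(2) unfolding unit_comm_def by metis
    define A where "A = W ** a"
    \<comment> \<open>Chosen so that \<open>B ** P ** A\<close> is
      \<open>W ** a ** b - \<gamma>\<close>, while the corner part of \<open>B\<close> is still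
      \<open>b\<close>, whence \<open>A ** P ** B\<close> is \<open>W ** a ** b\<close>.\<close>
    define B where "B = (W ** (a ** b) - \<gamma>) ** a'"
    have APW: "A ** (P ** W) = A" by (rule mult_gen_inverse) (simp add: A_def assoc a)
    have BPW: "B ** (P ** W) = B" by (rule mult_gen_inverse) (simp add: B_def assoc a)
    have ePB: "e ** (P ** B) = b"
    proof -
      have "e ** (P ** B) = ((e ** (P ** W)) ** (a ** b) - e ** P ** \<gamma>) ** a'"
        by (simp add: B_def matrix_distribs assoc)
      also have "\<dots> = (b ** a) ** a'"
        unfolding ePW' G by (simp add: matrix_mult_cancel_tail2[OF a(1)])
      also have "\<dots> = b" by (simp add: assoc a)
      finally show ?thesis .
    qed
    have "A ** (P ** B) = A ** b"
    proof -
      have "A ** (P ** B) = A ** (e ** (P ** B))"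
        by (simp add: A_def assoc matrix_mult_cancel_tail2[OF a(2)])
      then show ?thesis by (simp add: ePB)
    qed
    moreover have "B ** (P ** A) = W ** (a ** b) - \<gamma>"
    proof -
      have "B ** (P ** A) = B ** (P ** W) ** a" by (simp add: A_def assoc)
      also have "\<dots> = (W ** (a ** b) - \<gamma>) ** e" unfolding BPW by (simp add: B_def assoc a)
      finally show ?thesis by (simp add: matrix_distribs assoc a \<gamma>)
    qed
    ultimately have "comm_P P A B = \<gamma>"
      by (simp add: comm_P_def smult_P_def A_def assoc)
    then show ?thesis using mult_gen_inverse[OF \<gamma>(1)]
      by (auto simp: comms_P_def assoc intro!: bexI[of _ "comm_P P A B"])
  qed
  then obtain C where C: "C \<in> comms_P P" "C ** P ** W = \<gamma>" by blast
  have "\<exists>D\<in>comms_P P. e ** P ** D = \<delta>"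
  proof -
    obtain a a' b where a: "e ** a = a" "a ** e = a" "e ** a' = a'" "a' ** e = a'"
      "e ** b = b" "b ** e = b" "a ** a' = e" "a' ** a = e" and H: "\<delta> ** P ** W = a ** b - b ** a"
      using \<delta>(2) unfolding unit_comm_def by metis
    \<comment> \<open>Solves \<open>a ** \<beta> - b ** a = \<delta>\<close>; the commutator formula
      for the corner part of \<open>\<delta>\<close> then gives
      \<open>\<beta> ** P ** W = b\<close>, as needed for consistency.\<close>
    define \<beta> where "\<beta> = a' ** (\<delta> + b ** a)"
    have \<beta>PW: "\<beta> ** (P ** W) = b"
    proof -
      have "\<beta> ** (P ** W) = a' ** (\<delta> ** P ** W + b ** (a ** (P ** W)))"
        by (simp add: \<beta>_def matrix_distribs assoc)
      also have "\<dots> = a' ** (a ** b)"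
        unfolding mult_gen_inverse[OF a(2)] H by simp
      also have "\<dots> = b" by (simp add: matrix_mult_cancel_tail2[OF a(8)] a)
      finally show ?thesis .
    qed
    have "e ** (P ** (W ** (a ** (P ** (W ** \<beta>))))) = (e ** (P ** W)) ** (a ** (P ** W)) ** \<beta>"
      by (simp add: assoc)
    also have "\<dots> = a ** \<beta>"
      unfolding ePW' mult_gen_inverse[OF a(2)] a by simp
    also have "\<dots> = \<delta> + b ** a"
      by (simp add: \<beta>_def matrix_mult_cancel_tail2[OF a(7)] matrix_distribs \<delta>
          matrix_mult_cancel_tail2[OF a(5)])
    finally have 1: "e ** (P ** (W ** (a ** (P ** (W ** \<beta>))))) = \<delta> + b ** a" .
    have "e ** (P ** (W ** (\<beta> ** (P ** (W ** a))))) = (e ** (P ** W)) ** (\<beta> ** (P ** W)) ** a"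
      by (simp add: assoc)
    also have "\<dots> = b ** a" unfolding ePW' \<beta>PW a ..
    finally have "e ** P ** comm_P P (W ** a) (W ** \<beta>) = \<delta>"
      using 1 by (simp add: comm_P_def smult_P_def matrix_distribs assoc)
    then show ?thesis by (auto simp: comms_P_def)
  qed
  then obtain D where D: "D \<in> comms_P P" "e ** P ** D = \<delta>" by blast
  have "\<gamma> ** \<delta> = C ** (P ** (W ** e) ** P) ** D"
    unfolding C(2)[symmetric] D(2)[symmetric] by (simp add: assoc)
  also have "\<dots> = smult_P P C D" by (simp add: We PWP smult_P_def)
  finally show ?thesis using C(1) D(1) unfolding comm_prods_P_def by blast
qed

text \<open>An injection of \<open>S\<close> into \<open>t\<close> disjoint copies of
  \<open>I\<close> splits the idempotent of \<open>S\<close> into \<open>t\<close> pieces, each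
  factoring through the corner.\<close>

lemma diag_ind_split:
  fixes S :: "'q::finite set"
  assumes "card S \<le> t * card I"
  obtains F :: "nat \<Rightarrow> 'a^'n^'q" and F' :: "nat \<Rightarrow> 'a^'q^'n" where
    "\<forall>g. F g ** e = F g \<and> e ** F' g = F' g" "(\<Sum>g<t. F g ** F' g) = diag_ind S"
proof -
  have "card S \<le> card ({..<t} \<times> I)" unfolding card_cartesian_product card_lessThan by (rule assms)
  then obtain h where h: "h ` S \<subseteq> {..<t} \<times> I" "inj_on h S"
    using card_le_inj[of S "{..<t} \<times> I"] by (metis finite finite_SigmaI finite_lessThan)
  define F :: "nat \<Rightarrow> 'a^'n^'q" where "F g = (\<chi> q k. if q \<in> S \<and> h q = (g, k) then 1 else 0)" for g
  define F' :: "nat \<Rightarrow> 'a^'q^'n" where "F' g = (\<chi> k q. if q \<in> S \<and> h q = (g, k) then 1 else 0)" for g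
  have comp: "(F g ** F' g) $ q $ q' = (if g = fst (h q) then if q = q' \<and> q \<in> S then 1 else 0 else 0)" for g q q'
  proof -
    have "(F g ** F' g) $ q $ q'
      = (\<Sum>k\<in>UNIV. if k = snd (h q) then if g = fst (h q) \<and> q = q' \<and> q \<in> S then 1 else 0 else 0)"
      unfolding matrix_mult_component
    proof (rule sum.cong[OF refl])
      fix k
      have "h q = h q' \<longleftrightarrow> q = q'" if "q \<in> S" "q' \<in> S"
        using h(2) that by (rule inj_on_eq_iff)
      then show "F g $ q $ k * F' g $ k $ q'
          = (if k = snd (h q) then if g = fst (h q) \<and> q = q' \<and> q \<in> S then 1 else 0 else 0)"
        by (cases "h q") (auto simp: F_def F'_def)
    qed
    then show ?thesis by simp
  qed
  have "(\<Sum>g<t. F g ** F' g) $ q $ q' = diag_ind S $ q $ q'" for q q'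
  proof (cases "q \<in> S")
    case True
    then have "fst (h q) < t" using h(1) by force
    then show ?thesis by (simp add: comp diag_ind_def)
  next
    case False
    then show ?thesis by (simp add: comp diag_ind_def)
  qed
  then have "(\<Sum>g<t. F g ** F' g) = diag_ind S" by (simp add: vec_eq_iff)
  moreover have "F g ** e = F g" "e ** F' g = F' g" for g
    using h(1) by (auto simp: e_def vec_eq_iff mult_diag_ind_component diag_ind_mult_component F_def F'_def)
  ultimately show ?thesis using that by blast
qed

text \<open>The outer factors have zero corner parts, and zero is an admissible corner commutator,
  so every factorization through the corner is allowed. The left outer factor kills
  \<open>diag_ind J\<close> and the right one is killed by \<open>e\<close>; a split idempotent of
  either complement can thus be inserted, whichever is small enough.\<close>

lemma annihilated_sum_of_products:
  fixes J :: "'m set" and Y :: "'a^'n^'m"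
  assumes WPJ: "W ** P ** diag_ind J = diag_ind J"
    and small: "card (- J) \<le> t * card I \<or> card (- I) \<le> t * card I"
  obtains Q where "\<And>g. Q g \<in> comm_prods_P P"
    "(mat 1 - W ** P) ** Y ** (mat 1 - P ** W) = (\<Sum>g<t. Q g)"
proof -
  note assoc = matrix_mul_assoc[symmetric]
  define E where "E = mat 1 - W ** P"
  define E' where "E' = mat 1 - P ** W"
  have eP_E: "e ** P ** (E ** A) = 0" for A :: "'a^'n^'m"
  proof -
    have "e ** P ** E = 0" using ePW by (simp add: E_def matrix_distribs matrix_mul_assoc)
    then show ?thesis by (simp add: matrix_mul_assoc)
  qed
  have E'_PW: "(A ** E') ** P ** W = 0" for A :: "'a^'n^'n"
  proof -
    have "E' ** P = 0" using PWP by (simp add: E'_def matrix_distribs matrix_mul_assoc)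
    then show ?thesis by (simp add: assoc matrix_mult_cancel_tail2)
  qed
  have mem: "(E ** A) ** (B ** E') \<in> comm_prods_P P" if "A ** e = A" "e ** B = B"
    for A :: "'a^'n^'m" and B :: "'a^'n^'n"
  proof (rule product_mem_comm_prods)
    show "E ** A ** e = E ** A" using that by (simp add: assoc)
    show "e ** (B ** E') = B ** E'" using that by (simp add: matrix_mul_assoc)
    show "unit_comm e (e ** P ** (E ** A))" "unit_comm e (B ** E' ** P ** W)"
      unfolding eP_E E'_PW by (rule unit_comm_zero[OF corner_unit_idem])+
  qed
  have compl: "mat 1 = diag_ind S + diag_ind (- S)" for S :: "'q::finite set"
    by (auto simp: vec_eq_iff mat_def diag_ind_def)
  from small show ?thesis
  proof
    assume "card (- J) \<le> t * card I"
    then obtain F :: "nat \<Rightarrow> 'a^'n^'m" and F' :: "nat \<Rightarrow> 'a^'m^'n" where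
      F: "\<forall>g. F g ** e = F g \<and> e ** F' g = F' g" "(\<Sum>g<t. F g ** F' g) = diag_ind (- J)"
      by (rule diag_ind_split)
    have "E ** diag_ind J = 0" using WPJ by (simp add: E_def matrix_distribs)
    then have "E = E ** diag_ind (- J)"
      by (metis add.left_neutral compl matrix_add_ldistrib matrix_mul_rid)
    then have "E ** Y ** E' = E ** (\<Sum>g<t. F g ** F' g) ** Y ** E'" using F(2) by simp
    also have "\<dots> = (\<Sum>g<t. (E ** F g) ** (F' g ** Y ** E'))"
      by (simp add: matrix_sum_ldistrib matrix_sum_rdistrib matrix_mul_assoc)
    finally have "E ** Y ** E' = (\<Sum>g<t. (E ** F g) ** (F' g ** Y ** E'))" .
    moreover have "(E ** F g) ** (F' g ** Y ** E') \<in> comm_prods_P P" for g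
      using F(1) by (intro mem) (simp_all add: matrix_mul_assoc)
    ultimately show ?thesis by (intro that) (simp_all add: E_def E'_def)
  next
    assume "card (- I) \<le> t * card I"
    then obtain F :: "nat \<Rightarrow> 'a^'n^'n" and F' :: "nat \<Rightarrow> 'a^'n^'n" where
      F: "\<forall>g. F g ** e = F g \<and> e ** F' g = F' g" "(\<Sum>g<t. F g ** F' g) = diag_ind (- I)"
      by (rule diag_ind_split)
    have "e ** E' = 0" using ePW by (simp add: E'_def matrix_distribs matrix_mul_assoc)
    then have "E' = diag_ind (- I) ** E'"
      by (metis add.left_neutral compl e_def matrix_add_rdistrib matrix_mul_lid)
    then have "E ** Y ** E' = E ** Y ** ((\<Sum>g<t. F g ** F' g) ** E')" using F(2) by simp
    also have "\<dots> = (\<Sum>g<t. (E ** (Y ** F g)) ** (F' g ** E'))"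
      by (simp add: matrix_sum_ldistrib matrix_sum_rdistrib matrix_mul_assoc)
    finally have "E ** Y ** E' = (\<Sum>g<t. (E ** (Y ** F g)) ** (F' g ** E'))" .
    moreover have "(E ** (Y ** F g)) ** (F' g ** E') \<in> comm_prods_P P" for g
      using F(1) by (intro mem) (simp_all add: assoc)
    ultimately show ?thesis by (intro that) (simp_all add: E_def E'_def)
  qed
qed

lemma sumsN_comm_prods_UNIV:
  fixes J :: "'m set"
  assumes WPJ: "W ** P ** diag_ind J = diag_ind J"
    and small: "card (- J) \<le> t * card I \<or> card (- I) \<le> t * card I"
    and I: "card I \<ge> 2"
  shows "sumsN (4 + t) (comm_prods_P P) = UNIV"
proof -
  note assoc = matrix_mul_assoc[symmetric]
  have "X \<in> sumsN (4 + t) (comm_prods_P P)" for X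
  proof -
    obtain f where "bij_betw f {0..<card I} I" using ex_bij_betw_nat_finite[of I] by auto
    then have inj: "inj_on f {..<card I}" and img: "f ` {..<card I} = I"
      by (auto simp: bij_betw_def lessThan_atLeast0)
    have e: "e = diag_ind (f ` {..<card I})" by (simp add: img e_def)
    define X1 where "X1 = e ** P ** X ** P ** W"
    have X1: "e ** X1 = X1" "X1 ** e = X1"
      by (simp_all add: X1_def assoc We matrix_mult_cancel_tail2[OF corner_unit_idem])
    obtain G H R K :: "nat \<Rightarrow> 'a^'n^'n" where
      GH_all: "\<forall>i. unit_comm e (G i) \<and> unit_comm e (H i)"
      and RK: "\<forall>i. e ** R i = R i \<and> K i ** e = K i"
      and sums: "(\<Sum>i<4. G i ** H i) = X1" "(\<Sum>i<4. G i ** R i) = e" "(\<Sum>i<4. K i ** H i) = e"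
      by (rule corner_sum_of_four_products[OF inj I e X1])
    have GH: "unit_comm e (G i)" "unit_comm e (H i)" for i
      using GH_all by auto
    \<comment> \<open>\<open>A\<close> and \<open>B\<close> are the parts of \<open>X\<close>
      outside the corner on one side only. The factors in \<open>L\<close> carry them through
      \<open>K\<close> and \<open>R\<close>, so the three sum identities reproduce the corner part,
      \<open>B\<close> and \<open>A\<close>; the remaining cross terms add up to
      \<open>A ** Z ** B\<close>.\<close>
    define A where "A = (mat 1 - W ** P) ** X ** P ** W"
    define B where "B = e ** P ** X ** (mat 1 - P ** W)"
    define Z where "Z = (\<Sum>i<4. K i ** R i)"
    \<comment> \<open>The subtracted term compensates for \<open>A ** Z ** B\<close>, which also
      lies outside the corner on both sides.\<close>
    define Y where "Y = X - X ** P ** W ** Z ** e ** P ** X"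
    define L where "L i = (W ** G i + A ** K i) ** (H i + R i ** B)" for i
    have eP_A: "e ** P ** A = 0"
      using ePW by (simp add: A_def matrix_distribs matrix_mul_assoc)
    have B_PW: "B ** P ** W = 0"
      using PWP by (simp add: B_def matrix_distribs assoc)
    have L: "L i \<in> comm_prods_P P" for i
      unfolding L_def
    proof (rule product_mem_comm_prods)
      have "e ** P ** (W ** G i + A ** K i) = (e ** P ** W) ** G i + (e ** P ** A) ** K i"
        by (simp add: matrix_distribs assoc)
      then show "unit_comm e (e ** P ** (W ** G i + A ** K i))"
        using GH(1) unit_comm_corner[OF GH(1)] by (simp add: ePW eP_A)
      have "(H i + R i ** B) ** P ** W = H i ** (P ** W) + R i ** (B ** P ** W)"
        by (simp add: matrix_distribs assoc)
      then show "unit_comm e ((H i + R i ** B) ** P ** W)"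
        using GH(2) unit_comm_corner[OF GH(2)] by (simp add: mult_gen_inverse B_PW)
      show "(W ** G i + A ** K i) ** e = W ** G i + A ** K i"
        using unit_comm_corner[OF GH(1)] by (simp add: matrix_distribs assoc RK)
      show "e ** (H i + R i ** B) = H i + R i ** B"
        using unit_comm_corner[OF GH(2)] by (simp add: matrix_distribs matrix_mul_assoc RK)
    qed
    have "(\<Sum>i<4. L i) = W ** (\<Sum>i<4. G i ** H i) + W ** (\<Sum>i<4. G i ** R i) ** B
        + A ** (\<Sum>i<4. K i ** H i) + A ** Z ** B"
      by (simp add: L_def Z_def matrix_distribs matrix_sum_ldistrib matrix_sum_rdistrib sum.distrib
          matrix_mul_assoc add.assoc add.left_commute)
    also have "\<dots> = W ** X1 + W ** B + A + A ** Z ** B"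
      unfolding sums by (simp add: We A_def assoc)
    also have "\<dots> = X - (mat 1 - W ** P) ** Y ** (mat 1 - P ** W)"
      by (simp add: X1_def A_def B_def Y_def matrix_distribs matrix_mul_assoc We algebra_simps)
    finally have LX: "(\<Sum>i<4. L i) + (mat 1 - W ** P) ** Y ** (mat 1 - P ** W) = X" by simp
    obtain Q where Q: "\<And>g. Q g \<in> comm_prods_P P"
      "(mat 1 - W ** P) ** Y ** (mat 1 - P ** W) = (\<Sum>g<t. Q g)"
      using annihilated_sum_of_products[OF WPJ small] by metis
    have "sum_list (map L [0..<4] @ map Q [0..<t]) = X"
      using LX by (simp add: Q(2) interv_sum_list_conv_sum_set_nat lessThan_atLeast0 del: upt_Suc upt_rec_numeral)
    moreover have "set (map L [0..<4] @ map Q [0..<t]) \<subseteq> comm_prods_P P"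
      using L Q(1) by auto
    ultimately show ?thesis
      unfolding sumsN_def by (intro CollectI exI[of _ "map L [0..<4] @ map Q [0..<t]"]) auto
  qed
  then show ?thesis by blast
qed

text \<open>Each product factors through the \<open>card I\<close> coordinates of the corner, so
  \<open>N\<close> of them cannot produce a matrix containing an identity block of size greater than
  \<open>N * card I\<close>.\<close>

lemma sumsN_comm_prods_UNIV_lower:
  assumes "sumsN N (comm_prods_P P) = UNIV"
  shows "min CARD('m) CARD('n) \<le> N * card I"
proof (rule ccontr)
  define s where "s = min CARD('m) CARD('n)"
  assume "\<not> min CARD('m) CARD('n) \<le> N * card I"
  then have less: "card ({..<N} \<times> I) < card {..<s}" unfolding s_def card_cartesian_product card_lessThan not_le .
  obtain u :: "nat \<Rightarrow> 'm" where u: "inj_on u {..<s}"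
    using card_le_inj[of "{..<s}" "UNIV :: 'm set"] by (auto simp: s_def)
  obtain v :: "nat \<Rightarrow> 'n" where v: "inj_on v {..<s}"
    using card_le_inj[of "{..<s}" "UNIV :: 'n set"] by (auto simp: s_def)
  define X :: "'a^'n^'m" where "X = (\<chi> a b. if \<exists>i<s. a = u i \<and> b = v i then 1 else 0)"
  have X: "X $ u i $ v j = (if j = i then 1 else 0)" if "i < s" "j < s" for i j
    using that u v by (auto simp: X_def inj_on_def)
  obtain xs where xs: "X = sum_list xs" "length xs = N" "set xs \<subseteq> comm_prods_P P"
    using assms unfolding sumsN_def by blast
  have "\<exists>A B. xs ! g = A ** B \<and> A ** e = A" if "g < N" for g
  proof -
    have "xs ! g \<in> comm_prods_P P" using that xs by auto
    then obtain C D where "xs ! g = C ** P ** D"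
      unfolding comm_prods_P_def smult_P_def by blast
    also have "\<dots> = (C ** P ** W) ** (P ** D)"
      by (subst PWP[symmetric]) (simp add: matrix_mul_assoc)
    finally show ?thesis using We by (metis matrix_mul_assoc)
  qed
  then obtain A :: "nat \<Rightarrow> 'a^'n^'m" and B :: "nat \<Rightarrow> 'a^'n^'n"
    where AB: "\<And>g. g < N \<Longrightarrow> xs ! g = A g ** B g \<and> A g ** e = A g" by metis
  have A0: "A g $ a $ k = 0" if "g < N" "k \<notin> I" for g a k
    using AB[OF that(1)] that(2) by (metis e_def mult_diag_ind_component)
  have X_sum: "X $ a $ b = (\<Sum>(g, k)\<in>{..<N} \<times> I. A g $ a $ k * B g $ k $ b)" for a b
  proof -
    have "X = (\<Sum>g<N. A g ** B g)"
      unfolding xs(1) sum_list_sum_nth xs(2) using AB by (simp add: lessThan_atLeast0)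
    then have "X $ a $ b = (\<Sum>g<N. \<Sum>k\<in>UNIV. A g $ a $ k * B g $ k $ b)"
      by (simp add: matrix_mult_component)
    also have "\<dots> = (\<Sum>g<N. \<Sum>k\<in>I. A g $ a $ k * B g $ k $ b)"
      by (intro sum.cong sum.mono_neutral_right) (auto simp: A0)
    finally show ?thesis by (simp add: sum.cartesian_product)
  qed
  \<comment> \<open>With one equation for each pair of a summand and a corner index there are fewer
    equations than unknowns. The solution is killed by every right factor, hence by
    \<open>X\<close>, yet the identity block of \<open>X\<close> reproduces it.\<close>
  obtain c i where c: "i < s" "c i \<noteq> 0"
    and eq: "\<And>g k. g < N \<Longrightarrow> k \<in> I \<Longrightarrow> (\<Sum>j<s. B g $ k $ v j * c j) = 0"
    using homogeneous_system_nontrivial_solution[OF _ _ less, of "\<lambda>(g, k) j. B g $ k $ v j"]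
    by fastforce
  have "c i = (\<Sum>j<s. X $ u i $ v j * c j)"
  proof -
    have "(\<Sum>j<s. X $ u i $ v j * c j) = (\<Sum>j<s. (if j = i then 1 else 0) * c j)"
      using c(1) by (intro sum.cong) (auto simp: X)
    then show ?thesis using c(1) by (simp add: sum_if_eq_mult)
  qed
  also have "\<dots> = (\<Sum>j<s. \<Sum>p\<in>{..<N} \<times> I. A (fst p) $ u i $ snd p * (B (fst p) $ snd p $ v j * c j))"
    unfolding X_sum by (simp add: sum_distrib_right mult.assoc case_prod_beta)
  also have "\<dots> = (\<Sum>p\<in>{..<N} \<times> I. A (fst p) $ u i $ snd p * (\<Sum>j<s. B (fst p) $ snd p $ v j * c j))"
    by (subst sum.swap) (simp add: sum_distrib_left)
  also have "\<dots> = 0" by (intro sum.neutral) (auto simp: eq)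
  finally show False using c(2) by simp
qed

end

theorem theorem2p8:
  fixes P :: "'a::division_ring ^ 'm::finite ^ 'n::finite"
  assumes "CARD('m) \<ge> 2" and "CARD('n) \<ge> 2"
    and "mat_rank P \<ge> 2"
  shows "(\<exists>N. sumsN N (comm_prods_P P) = (UNIV :: ('a^'n^'m) set))
    \<and> \<lceil>real (min CARD('m) CARD('n)) / real (mat_rank P)\<rceil> \<le> int (xi_P P)
    \<and> int (xi_P P) \<le> \<lceil>real (min CARD('m) CARD('n)) / real (mat_rank P)\<rceil> + 3"
proof -
  define s where "s = min CARD('m) CARD('n)"
  define r where "r = mat_rank P"
  define k where "k = \<lceil>real s / real r\<rceil>"
  obtain I J and W :: "'a^'n^'m" where I: "card I = r" and J: "card J = r"
    and W: "P ** W ** P = P" "W ** diag_ind I = W" "diag_ind I ** P ** W = diag_ind I"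
    and WPJ: "W ** P ** diag_ind J = diag_ind J"
    unfolding r_def by (rule mat_rank_generalized_inverse)
  have r: "r \<ge> 2" and s: "s \<ge> 2" using assms by (auto simp: r_def s_def)
  have "0 < real s / real r" using r s by simp
  then have "k \<ge> 1" by (simp add: k_def)
  \<comment> \<open>Since \<open>k = t + 1\<close>, four products for the corner and
    \<open>t\<close> for the remainder make \<open>k + 3\<close>.\<close>
  then obtain t where t: "k = int (Suc t)" by (metis zle_iff_zadd of_nat_Suc)
  have "real s / real r \<le> real (Suc t)"
    using le_of_int_ceiling[of "real s / real r"] by (simp add: k_def[symmetric] t)
  then have "real s \<le> real (Suc t) * real r" using r by (simp add: divide_le_eq del: of_nat_Suc)
  then have "s \<le> Suc t * r" by (metis of_nat_le_iff of_nat_mult)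
  moreover have "card (- J) = CARD('m) - r" "card (- I) = CARD('n) - r"
    by (simp_all add: Compl_eq_Diff_UNIV card_Diff_subset I J)
  ultimately have "card (- J) \<le> t * card I \<or> card (- I) \<le> t * card I"
    unfolding I s_def by (cases "CARD('m) \<le> CARD('n)") auto
  then have full: "sumsN (4 + t) (comm_prods_P P) = UNIV"
    using sumsN_comm_prods_UNIV[OF W refl WPJ] r I by simp
  then have "xi_P P \<le> 4 + t" unfolding xi_P_def by (rule Least_le)
  moreover have "sumsN (xi_P P) (comm_prods_P P) = UNIV"
    unfolding xi_P_def using full by (rule LeastI)
  then have "s \<le> xi_P P * r"
    using sumsN_comm_prods_UNIV_lower[OF W refl] I by (simp add: s_def)
  then have "real s \<le> real (xi_P P) * real r" by (metis of_nat_le_iff of_nat_mult)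
  then have "k \<le> int (xi_P P)"
    using r by (simp add: k_def ceiling_le_iff divide_le_eq)
  ultimately show ?thesis
    using full unfolding k_def[symmetric, unfolded s_def r_def] by (auto simp: t)
qed

end
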